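(* Let $G$ and $J$ be graphs. If every minimum small common neighbourhood set $S$ of $G \vee J$ satisfies $S \subseteq V(G)$ or $S \subseteq V(J)$, then $c_H(G \vee J) \leq \Upsilon(G \vee J) + 1$.
   Context: The join $G \vee J$ has vertex set $V(G) \cup V(J)$ (disjoint union) and edge set $E(G) \cup E(J) \cup \{uv : u \in V(G), v \in V(J)\}$. For a graph $H$, $N(v)$ is the open neighbourhood of $v$; a non-empty set $S \subseteq V(H)$ is a small common neighbourhood set of $H$ if $\left|\bigcap_{v\in S} N(v)\right| \le |S|$; $\Upsilon(H)$ is the minimum cardinality of such a set, and a minimum small common neighbourhood set is one of cardinality $\Upsilon(H)$. Hyperopic Cops and Robber on $H$ (each vertex considered to carry a loop, so a player may stay put): the cops first occupy a multiset of vertices, then the robber chooses a vertex. In each round, each cop moves to an adjacent vertex or stays, then the robber moves to an adjacent vertex or stays. The robber always sees all cops. The cops see the robber's position except when the robber's vertex is adjacent to every vertex occupied by a cop, in which case the robber is invisible. The robber is captured when a cop occupies the robber's vertex. $c_H(H)$ is the minimum number of cops that can guarantee capture in finitely many moves. *)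

theory Defs
  imports "Graph_Theory.Pair_Digraph"
begin

text \<open>A finite simple graph is a \<open>pair_graph\<close>: a finite, symmetric, loop-free
  set of pairs, each edge \<open>uv\<close> being the two arcs \<open>(u, v)\<close> and \<open>(v, u)\<close>.\<close>

definition graph_join ::
  "'a pair_pre_digraph \<Rightarrow> 'b pair_pre_digraph \<Rightarrow> ('a + 'b) pair_pre_digraph" where
  "graph_join G J = \<lparr>
     pverts = pverts G <+> pverts J,
     parcs = map_prod Inl Inl ` parcs G \<union> map_prod Inr Inr ` parcs J
       \<union> (Inl ` pverts G) \<times> (Inr ` pverts J) \<union> (Inr ` pverts J) \<times> (Inl ` pverts G) \<rparr>"

lemma pair_graph_graph_join:
  assumes "pair_graph G" "pair_graph J"
  shows "pair_graph (graph_join G J)"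
proof -
  interpret G: pair_graph G by fact
  interpret J: pair_graph J by fact
  have sym: "sym (parcs G)" "sym (parcs J)"
    using G.pair_sym_arcs J.pair_sym_arcs by (simp_all add: symmetric_def)
  have fin: "finite (pverts G)" "finite (pverts J)" "finite (parcs G)" "finite (parcs J)"
    by (fact G.pair_finite_verts J.pair_finite_verts G.pair_finite_arcs J.pair_finite_arcs)+
  have arcG: "u \<in> pverts G" "v \<in> pverts G" "u \<noteq> v" if "(u, v) \<in> parcs G" for u v
    using G.arc_fst_in_verts[OF that] G.arc_snd_in_verts[OF that] G.pair_no_loops[OF that]
    by simp_all
  have arcJ: "u \<in> pverts J" "v \<in> pverts J" "u \<noteq> v" if "(u, v) \<in> parcs J" for u v
    using J.arc_fst_in_verts[OF that] J.arc_snd_in_verts[OF that] J.pair_no_loops[OF that]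
    by simp_all
  have arc: "fst e \<in> pverts (graph_join G J) \<and> snd e \<in> pverts (graph_join G J) \<and> fst e \<noteq> snd e"
    if "e \<in> parcs (graph_join G J)" for e
    using that arcG arcJ unfolding graph_join_def by (cases e) (simp, elim disjE; fastforce)
  have "sym (parcs (graph_join G J))"
    using sym unfolding graph_join_def sym_def by (simp, blast)
  moreover have "finite (pverts (graph_join G J))" "finite (parcs (graph_join G J))"
    using fin by (simp_all add: graph_join_def)
  ultimately show ?thesis
    using arc by unfold_locales (simp_all add: symmetric_def)
qed

definition nbhd :: "'a pair_pre_digraph \<Rightarrow> 'a \<Rightarrow> 'a set" where
  "nbhd H v = {u. (v, u) \<in> parcs H}"

definition small_common_nbhd_set :: "'a pair_pre_digraph \<Rightarrow> 'a set \<Rightarrow> bool" where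
  "small_common_nbhd_set H S \<longleftrightarrow>
     S \<noteq> {} \<and> S \<subseteq> pverts H \<and> card (\<Inter>v\<in>S. nbhd H v) \<le> card S"

definition Upsilon :: "'a pair_pre_digraph \<Rightarrow> nat" where
  "Upsilon H = (LEAST n. \<exists>S. small_common_nbhd_set H S \<and> card S = n)"

definition min_small_common_nbhd_set :: "'a pair_pre_digraph \<Rightarrow> 'a set \<Rightarrow> bool" where
  "min_small_common_nbhd_set H S \<longleftrightarrow> small_common_nbhd_set H S \<and> card S = Upsilon H"

text \<open>A move of a single player; staying put is the use of the loop.\<close>

definition step :: "'a pair_pre_digraph \<Rightarrow> 'a \<Rightarrow> 'a \<Rightarrow> bool" where
  "step H u v \<longleftrightarrow> u \<in> pverts H \<and> (v = u \<or> (u, v) \<in> parcs H)"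

text \<open>What the cops, standing on the vertices listed in \<open>cs\<close>, see of a robber on \<open>v\<close>:
  \<open>None\<close> if he is invisible. Adjacency is that of the loop-free graph; a loop could
  only make a difference if a cop is on \<open>v\<close>, when the robber is already captured.\<close>

definition observe :: "'a pair_pre_digraph \<Rightarrow> 'a list \<Rightarrow> 'a \<Rightarrow> 'a option" where
  "observe H cs v = (if \<forall>c\<in>set cs. (c, v) \<in> parcs H then None else Some v)"

text \<open>A strategy \<open>\<sigma>\<close> maps the list of everything observed so far to the next cop
  positions, with \<open>\<sigma> []\<close> the initial placement. Cop positions are lists so that individual
  cops can be followed and vertices may carry several cops. As \<open>\<sigma>\<close> is deterministic, the
  observations determine all earlier cop positions.

  For a sequence \<open>r\<close> of robber positions, \<open>history H \<sigma> r n\<close> is what the cops have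
  observed just before their move in round \<open>n\<close>. They look after each robber move and also
  after each cop move. \<open>cops_at H \<sigma> r n\<close> are their positions at that time.\<close>

type_synonym 'a strategy = "'a option list \<Rightarrow> 'a list"

primrec history ::
  "'a pair_pre_digraph \<Rightarrow> 'a strategy \<Rightarrow> (nat \<Rightarrow> 'a) \<Rightarrow> nat \<Rightarrow> 'a option list" where
  "history H \<sigma> r 0 = [observe H (\<sigma> []) (r 0)]"
| "history H \<sigma> r (Suc n) = history H \<sigma> r n @
     [observe H (\<sigma> (history H \<sigma> r n)) (r n), observe H (\<sigma> (history H \<sigma> r n)) (r (Suc n))]"

primrec cops_at ::
  "'a pair_pre_digraph \<Rightarrow> 'a strategy \<Rightarrow> (nat \<Rightarrow> 'a) \<Rightarrow> nat \<Rightarrow> 'a list" where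
  "cops_at H \<sigma> r 0 = \<sigma> []"
| "cops_at H \<sigma> r (Suc n) = \<sigma> (history H \<sigma> r n)"

text \<open>Since strategies are deterministic, ranging over all walks of the robber covers all
  ways in which he can react to the cops, whom he sees.\<close>

definition robber_walk :: "'a pair_pre_digraph \<Rightarrow> (nat \<Rightarrow> 'a) \<Rightarrow> bool" where
  "robber_walk H r \<longleftrightarrow> r 0 \<in> pverts H \<and> (\<forall>n. step H (r n) (r (Suc n)))"

definition legal_strategy :: "'a pair_pre_digraph \<Rightarrow> nat \<Rightarrow> 'a strategy \<Rightarrow> bool" where
  "legal_strategy H k \<sigma> \<longleftrightarrow>
     length (\<sigma> []) = k \<and> set (\<sigma> []) \<subseteq> pverts H \<and>
     (\<forall>r n. robber_walk H r \<longrightarrow>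
        list_all2 (step H) (cops_at H \<sigma> r n) (cops_at H \<sigma> r (Suc n)))"

text \<open>The robber may be caught by his own move (or initial choice) or by a cop's move.\<close>

definition captured_in_round ::
  "'a pair_pre_digraph \<Rightarrow> 'a strategy \<Rightarrow> (nat \<Rightarrow> 'a) \<Rightarrow> nat \<Rightarrow> bool" where
  "captured_in_round H \<sigma> r n \<longleftrightarrow>
     r n \<in> set (cops_at H \<sigma> r n) \<or> r n \<in> set (cops_at H \<sigma> r (Suc n))"

definition cops_win :: "'a pair_pre_digraph \<Rightarrow> nat \<Rightarrow> bool" where
  "cops_win H k \<longleftrightarrow>
     (\<exists>\<sigma>. legal_strategy H k \<sigma> \<and> (\<forall>r. robber_walk H r \<longrightarrow> (\<exists>n. captured_in_round H \<sigma> r n)))"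

definition hyperopic_cop_number :: "'a pair_pre_digraph \<Rightarrow> nat" where
  "hyperopic_cop_number H = (LEAST k. cops_win H k)"

text \<open>Both minima are over non-empty sets.\<close>

lemma cops_win_card_verts:
  assumes "pair_graph H"
  shows "cops_win H (card (pverts H))"
proof -
  interpret pair_graph H by fact
  obtain vs where vs: "set vs = pverts H" "distinct vs"
    using finite_distinct_list pair_finite_verts by blast
  let ?\<sigma> = "\<lambda>_ :: 'a option list. vs"
  have c: "cops_at H ?\<sigma> r n = vs" for r n by (cases n) auto
  have step: "list_all2 (step H) vs vs"
    using vs by (simp add: list_all2_conv_all_nth step_def nth_mem[of _ vs, simplified vs])
  have "length vs = card (pverts H)"
    using vs distinct_card by metis
  then have "legal_strategy H (card (pverts H)) ?\<sigma>"
    unfolding legal_strategy_def c using step vs(1) by simp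
  moreover have "captured_in_round H ?\<sigma> r 0" if "robber_walk H r" for r
    using that vs by (simp add: captured_in_round_def robber_walk_def)
  ultimately show ?thesis unfolding cops_win_def by blast
qed

lemma small_common_nbhd_set_verts:
  assumes "pair_graph H" "pverts H \<noteq> {}"
  shows "small_common_nbhd_set H (pverts H)"
proof -
  interpret pair_graph H by fact
  have "u \<notin> (\<Inter>v\<in>pverts H. nbhd H v)" for u
  proof
    assume "u \<in> (\<Inter>v\<in>pverts H. nbhd H v)"
    then have "(v, u) \<in> parcs H" if "v \<in> pverts H" for v using that by (auto simp: nbhd_def)
    moreover from this have "u \<in> pverts H" using assms(2) arc_snd_in_verts by fastforce
    ultimately have "(u, u) \<in> parcs H" by blast
    then show False using pair_no_loops by fastforce
  qed
  then have "(\<Inter>v\<in>pverts H. nbhd H v) = {}" by blast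
  then show ?thesis using assms(2) by (simp add: small_common_nbhd_set_def)
qed

end

(* The cops win at once: if S lies in V(G), k = |S| of them start on S and the last one on a vertex j of J.
   A robber seen in V(G) is adjacent to j. Every other robber, seen in V(J) or invisible, is in
   the common neighbourhood of S; all k cops on S are adjacent to each of its at most k
   vertices, so they can occupy all of it in one move without knowing where he is. *)

theory Submission
  imports Defs
begin

lemma list_all2_step_refl:
  assumes "set cs \<subseteq> pverts H"
  shows "list_all2 (step H) cs cs"
  using assms by (auto simp: list_all2_conv_all_nth step_def)

text \<open>Every vertex of \<open>ss\<close> is adjacent to the whole common neighbourhood, so it
  does not matter which cop goes where. The cardinality bound supplies enough cops, and those left
  over stay put.\<close>

lemma list_covering_common_nbhd:
  assumes "pair_graph H" "set ss \<subseteq> pverts H" "ss \<noteq> []"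
    and "card (\<Inter>v\<in>set ss. nbhd H v) \<le> length ss"
  obtains ts where "list_all2 (step H) ss ts" "set ts \<subseteq> pverts H"
    "(\<Inter>v\<in>set ss. nbhd H v) \<subseteq> set ts"
proof -
  interpret pair_graph H by fact
  let ?C = "\<Inter>v\<in>set ss. nbhd H v"
  \<comment> \<open>An empty \<open>ss\<close> would make the intersection \<open>UNIV\<close>; a
    single neighbourhood already bounds it.\<close>
  have C: "?C \<subseteq> pverts H"
    using assms(3) by (cases ss) (auto simp: nbhd_def dest: arc_snd_in_verts)
  then obtain cl where cl: "set cl = ?C" "distinct cl"
    using finite_distinct_list finite_subset pair_finite_verts by metis
  then have len: "length cl \<le> length ss"
    using assms(4) distinct_card by metis
  let ?ts = "cl @ drop (length cl) ss"
  have "list_all2 (step H) ss ?ts"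
    unfolding list_all2_conv_all_nth
  proof (intro conjI allI impI)
    show "length ss = length ?ts" using len by simp
    fix i assume i: "i < length ss"
    then have u: "ss ! i \<in> set ss" by simp
    show "step H (ss ! i) (?ts ! i)"
    proof (cases "i < length cl")
      case True
      then have "cl ! i \<in> ?C" using cl(1) nth_mem by blast
      then show ?thesis using u True assms(2) by (auto simp: step_def nth_append nbhd_def)
    next
      case False
      then show ?thesis using u i assms(2) len by (auto simp: step_def nth_append)
    qed
  qed
  moreover have "set ?ts \<subseteq> pverts H" "?C \<subseteq> set ?ts"
    using C cl(1) assms(2) by (auto dest: in_set_dropD)
  ultimately show ?thesis using that by blast
qed

text \<open>The condition \<open>cover\<close> is all that the join contributes. Stated for any
  \<open>H\<close>, it serves both the case of \<open>S\<close> on the left and that of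
  \<open>S\<close> on the right, with \<open>j\<close> on the opposite side.\<close>

lemma cops_win_small_common_nbhd_set:
  assumes "pair_graph H" and S: "small_common_nbhd_set H S" and j: "j \<in> pverts H"
    and cover: "\<And>v. v \<in> pverts H \<Longrightarrow> (j, v) \<in> parcs H \<or> v \<in> (\<Inter>s\<in>S. nbhd H s)"
  shows "cops_win H (card S + 1)"
proof -
  interpret pair_graph H by fact
  have SV: "S \<subseteq> pverts H" using S by (simp add: small_common_nbhd_set_def)
  then obtain ss where ss: "set ss = S" "distinct ss"
    using finite_distinct_list finite_subset pair_finite_verts by metis
  then have len: "length ss = card S" using distinct_card by metis
  obtain ts where ts: "list_all2 (step H) ss ts" "set ts \<subseteq> pverts H" "(\<Inter>s\<in>S. nbhd H s) \<subseteq> set ts"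
    using list_covering_common_nbhd[of H ss] assms(1) S ss(1) len
    by (auto simp: small_common_nbhd_set_def)
  \<comment> \<open>A robber seen at a non-neighbour of \<open>j\<close> gets the same answer as an
    invisible one: by \<open>cover\<close> he is in the common neighbourhood of \<open>S\<close>,
    hence on \<open>ts\<close>.\<close>
  define respond where "respond o1 = (case o1 of
      Some v \<Rightarrow> if (j, v) \<in> parcs H then v # ss else j # ts | None \<Rightarrow> j # ts)" for o1
  define \<sigma> :: "'a strategy" where "\<sigma> h = (if h = [] then j # ss else respond (hd h))" for h
  \<comment> \<open>Histories grow only at the end, so the head remains the observation of the
    initial position. The cops therefore stand still after their first move.\<close>
  have "history H \<sigma> r n \<noteq> [] \<and> hd (history H \<sigma> r n) = observe H (j # ss) (r 0)" for r n
    by (induction n) (auto simp: \<sigma>_def)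
  then have later: "cops_at H \<sigma> r (Suc n) = respond (observe H (j # ss) (r 0))" for r n
    by (simp add: \<sigma>_def)
  have respond_verts: "set (respond o1) \<subseteq> pverts H" for o1
    using j SV ss(1) ts(2) by (auto simp: respond_def dest: arc_snd_in_verts split: option.split)
  have first: "list_all2 (step H) (j # ss) (respond o1)" for o1
    using j SV ss(1) ts(1) list_all2_step_refl[of ss H]
    by (auto simp: respond_def step_def split: option.split)
  have "list_all2 (step H) (cops_at H \<sigma> r n) (cops_at H \<sigma> r (Suc n))" for r n
  proof (cases n)
    case 0
    then show ?thesis using first later by (simp add: \<sigma>_def del: cops_at.simps(2))
  next
    case (Suc m)
    then show ?thesis using list_all2_step_refl[OF respond_verts] by (simp only: later)
  qed
  then have "legal_strategy H (card S + 1) \<sigma>"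
    using len j SV ss(1) by (simp add: legal_strategy_def \<sigma>_def)
  moreover have "captured_in_round H \<sigma> r 0" if "robber_walk H r" for r
  proof -
    have "r 0 \<in> set (respond (observe H (j # ss) (r 0)))"
    proof (cases "observe H (j # ss) (r 0)")
      case None
      \<comment> \<open>Invisibility means adjacency to every cop, in particular to those on
        \<open>S\<close>.\<close>
      then have "r 0 \<in> (\<Inter>s\<in>S. nbhd H s)"
        using ss(1) by (auto simp: observe_def nbhd_def split: if_splits)
      then show ?thesis using None ts(3) by (auto simp: respond_def)
    next
      case (Some v)
      then have "v = r 0" by (auto simp: observe_def split: if_splits)
      then show ?thesis
        using Some cover[of v] ts(3) that by (auto simp: respond_def robber_walk_def)
    qed
    \<comment> \<open>The second disjunct is capture by the cops' own move in round 0.\<close>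
    then show ?thesis unfolding captured_in_round_def later by (rule disjI2)
  qed
  ultimately show ?thesis unfolding cops_win_def by blast
qed

text \<open>The whole vertex set is small, as no vertex is its own neighbour, so the
  \<open>LEAST\<close> in \<open>Upsilon\<close> is attained.\<close>

lemma ex_min_small_common_nbhd_set:
  assumes "pair_graph H" "pverts H \<noteq> {}"
  shows "\<exists>S. min_small_common_nbhd_set H S"
  unfolding min_small_common_nbhd_set_def Upsilon_def
  by (rule LeastI_ex) (use small_common_nbhd_set_verts[OF assms] in blast)

theorem theorem4p4:
  fixes G :: "'a pair_pre_digraph" and J :: "'b pair_pre_digraph"
  assumes "pair_graph G" and "pair_graph J"
    and "pverts G \<noteq> {}" and "pverts J \<noteq> {}"
    and "\<And>S. min_small_common_nbhd_set (graph_join G J) S \<Longrightarrow>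
           S \<subseteq> Inl ` pverts G \<or> S \<subseteq> Inr ` pverts J"
  shows "hyperopic_cop_number (graph_join G J) \<le> Upsilon (graph_join G J) + 1"
proof -
  let ?H = "graph_join G J"
  have H: "pair_graph ?H" using assms(1,2) by (rule pair_graph_graph_join)
  obtain x y where xy: "x \<in> pverts G" "y \<in> pverts J" using assms(3,4) by blast
  have V: "pverts ?H = Inl ` pverts G \<union> Inr ` pverts J"
    by (auto simp: graph_join_def)
  have E: "(Inl a, Inr b) \<in> parcs ?H" "(Inr b, Inl a) \<in> parcs ?H"
    if "a \<in> pverts G" "b \<in> pverts J" for a b
    using that by (auto simp: graph_join_def)
  obtain S where minS: "min_small_common_nbhd_set ?H S"
    using ex_min_small_common_nbhd_set[OF H] V xy by blast
  then have S: "small_common_nbhd_set ?H S" "card S = Upsilon ?H"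
    by (simp_all add: min_small_common_nbhd_set_def)
  have "cops_win ?H (card S + 1)"
    using assms(5)[OF minS]
  proof
    assume SG: "S \<subseteq> Inl ` pverts G"
    show ?thesis
    \<comment> \<open>Any vertex of \<open>J\<close> would do: it sees all of \<open>G\<close>, and
      every vertex of \<open>J\<close> is adjacent to all of \<open>S\<close>.\<close>
    proof (rule cops_win_small_common_nbhd_set[OF H S(1), of "Inr y"])
      show "Inr y \<in> pverts ?H" using V xy by blast
      show "(Inr y, v) \<in> parcs ?H \<or> v \<in> (\<Inter>s\<in>S. nbhd ?H s)" if "v \<in> pverts ?H" for v
        using that SG E xy unfolding V nbhd_def by blast
    qed
  next
    assume SJ: "S \<subseteq> Inr ` pverts J"
    show ?thesis
    proof (rule cops_win_small_common_nbhd_set[OF H S(1), of "Inl x"])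
      show "Inl x \<in> pverts ?H" using V xy by blast
      show "(Inl x, v) \<in> parcs ?H \<or> v \<in> (\<Inter>s\<in>S. nbhd ?H s)" if "v \<in> pverts ?H" for v
        using that SJ E xy unfolding V nbhd_def by blast
    qed
  qed
  then show ?thesis unfolding hyperopic_cop_number_def S(2) by (rule Least_le)
qed

end
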